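(* Let $D$ be an integral domain, and let $S$ be a splitting multiplicative subset of $D$ generated by primes. Then $D$ is a strong Furstenberg domain (resp., a TPDF-domain) if and only if the localization $D_S$ is a strong Furstenberg domain (resp., a TPDF-domain).
   Context: A prime element of an integral domain is a nonzero nonunit $p$ such that $p\mid ab$ implies $p\mid a$ or $p\mid b$. A saturated multiplicative subset $S$ of $D$ (with $0\notin S$) is called splitting if each $x\in D$ can be written as $x=as$ for some $a\in D$ and $s\in S$ such that $aD\cap tD=atD$ for all $t\in S$. $S$ is generated by primes if every element of $S$ is a unit of $D$ times a (possibly empty) finite product of prime elements of $D$ lying in $S$. An integral domain is a strong Furstenberg domain if every nonzero nonunit element has at least one prime divisor. It is a TPDF-domain if it is a strong Furstenberg domain and every nonzero element has only finitely many prime divisors up to associates. *)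

theory Defs
  imports "HOL-Algebra.Ring_Divisibility"
begin

definition prime_divisors :: "('a, 'b) ring_scheme \<Rightarrow> 'a \<Rightarrow> 'a set"
  where "prime_divisors R x =
    {p \<in> carrier R. ring_prime\<^bsub>R\<^esub> p \<and> p divides\<^bsub>R\<^esub> x}"

definition strong_furstenberg_domain :: "('a, 'b) ring_scheme \<Rightarrow> bool"
  where "strong_furstenberg_domain R \<longleftrightarrow>
    domain R \<and>
    (\<forall>x \<in> carrier R. x \<noteq> \<zero>\<^bsub>R\<^esub> \<and> x \<notin> Units R \<longrightarrow> prime_divisors R x \<noteq> {})"

definition TPDF_domain :: "('a, 'b) ring_scheme \<Rightarrow> bool"
  where "TPDF_domain R \<longleftrightarrow>
    strong_furstenberg_domain R \<and>
    (\<forall>x \<in> carrier R. x \<noteq> \<zero>\<^bsub>R\<^esub> \<longrightarrow>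
      (\<exists>F. finite F \<and> F \<subseteq> carrier R \<and> (\<forall>p \<in> prime_divisors R x. \<exists>q \<in> F. p \<sim>\<^bsub>R\<^esub> q)))"

definition saturated_mult_subset :: "('a, 'b) ring_scheme \<Rightarrow> 'a set \<Rightarrow> bool"
  where "saturated_mult_subset R S \<longleftrightarrow>
    submonoid S R \<and> \<zero>\<^bsub>R\<^esub> \<notin> S \<and>
    (\<forall>x \<in> carrier R. \<forall>y \<in> carrier R. x \<otimes>\<^bsub>R\<^esub> y \<in> S \<longrightarrow> x \<in> S \<and> y \<in> S)"

definition splitting_mult_subset :: "('a, 'b) ring_scheme \<Rightarrow> 'a set \<Rightarrow> bool"
  where "splitting_mult_subset R S \<longleftrightarrow>
    saturated_mult_subset R S \<and>
    (\<forall>x \<in> carrier R. \<exists>a \<in> carrier R. \<exists>s \<in> S.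
      x = a \<otimes>\<^bsub>R\<^esub> s \<and>
      (\<forall>t \<in> S. PIdl\<^bsub>R\<^esub> a \<inter> PIdl\<^bsub>R\<^esub> t = PIdl\<^bsub>R\<^esub> (a \<otimes>\<^bsub>R\<^esub> t)))"

definition generated_by_primes :: "('a, 'b) ring_scheme \<Rightarrow> 'a set \<Rightarrow> bool"
  where "generated_by_primes R S \<longleftrightarrow>
    (\<forall>s \<in> S. \<exists>u \<in> Units R. \<exists>ps.
      set ps \<subseteq> {p \<in> S. ring_prime\<^bsub>R\<^esub> p} \<and> s = u \<otimes>\<^bsub>R\<^esub> foldr (\<otimes>\<^bsub>R\<^esub>) ps \<one>\<^bsub>R\<^esub>)"

text \<open>
  \<open>loc_frac R S a s\<close> is the fraction \<open>a/s\<close>, that is, the class of \<open>(a, s)\<close> under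
  \<open>(a, s) \<approx> (b, t) \<longleftrightarrow> (\<exists>u \<in> S. u (a t - b s) = 0)\<close>. The factor \<open>u\<close> is
  needed only in the presence of zero divisors in \<open>S\<close>.
\<close>

definition loc_frac :: "('a, 'b) ring_scheme \<Rightarrow> 'a set \<Rightarrow> 'a \<Rightarrow> 'a \<Rightarrow> ('a \<times> 'a) set"
  where "loc_frac R S a s =
    {(b, t) | b t. b \<in> carrier R \<and> t \<in> S \<and>
      (\<exists>u \<in> S. u \<otimes>\<^bsub>R\<^esub> (a \<otimes>\<^bsub>R\<^esub> t \<ominus>\<^bsub>R\<^esub> b \<otimes>\<^bsub>R\<^esub> s) = \<zero>\<^bsub>R\<^esub>)}"

text \<open>
  The operations take the union over all representatives; they do not depend on the
  representatives, so this is a single class (see \<open>loc_mult_frac\<close> and \<open>loc_add_frac\<close>).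
\<close>

definition localization :: "('a, 'b) ring_scheme \<Rightarrow> 'a set \<Rightarrow> ('a \<times> 'a) set ring"
  where "localization R S =
    \<lparr>carrier = {loc_frac R S a s | a s. a \<in> carrier R \<and> s \<in> S},
     monoid.mult = (\<lambda>X Y. \<Union>(a, s) \<in> X. \<Union>(b, t) \<in> Y. loc_frac R S (a \<otimes>\<^bsub>R\<^esub> b) (s \<otimes>\<^bsub>R\<^esub> t)),
     one = loc_frac R S \<one>\<^bsub>R\<^esub> \<one>\<^bsub>R\<^esub>,
     zero = loc_frac R S \<zero>\<^bsub>R\<^esub> \<one>\<^bsub>R\<^esub>,
     add = (\<lambda>X Y. \<Union>(a, s) \<in> X. \<Union>(b, t) \<in> Y.
       loc_frac R S (a \<otimes>\<^bsub>R\<^esub> t \<oplus>\<^bsub>R\<^esub> b \<otimes>\<^bsub>R\<^esub> s) (s \<otimes>\<^bsub>R\<^esub> t))\<rparr>"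

context
  fixes R :: "('a, 'b) ring_scheme" (structure) and S
  assumes dom: "domain R" and mon: "submonoid S R" and zero_notin: "\<zero> \<notin> S"
begin

interpretation domain R by (rule dom)

private lemma S_carr: "s \<in> S \<Longrightarrow> s \<in> carrier R"
  using mon by (simp add: submonoid.mem_carrier)

private lemma S_mult: "s \<in> S \<Longrightarrow> t \<in> S \<Longrightarrow> s \<otimes> t \<in> S"
  using mon by (rule submonoid.m_closed)

private lemma S_one: "\<one> \<in> S"
  using mon by (rule submonoid.one_closed)

lemma mem_loc_frac_iff:
  assumes "a \<in> carrier R" "s \<in> S"
  shows "(b, t) \<in> loc_frac R S a s \<longleftrightarrow> b \<in> carrier R \<and> t \<in> S \<and> a \<otimes> t = b \<otimes> s"
proof -
  have "(\<exists>u \<in> S. u \<otimes> (a \<otimes> t \<ominus> b \<otimes> s) = \<zero>) \<longleftrightarrow> a \<otimes> t = b \<otimes> s"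
    if b: "b \<in> carrier R" and t: "t \<in> S"
  proof -
    have c: "a \<otimes> t \<in> carrier R" "b \<otimes> s \<in> carrier R"
      using assms b S_carr t by auto
    have "(\<exists>u \<in> S. u \<otimes> (a \<otimes> t \<ominus> b \<otimes> s) = \<zero>) \<longleftrightarrow> a \<otimes> t \<ominus> b \<otimes> s = \<zero>"
    proof
      assume "\<exists>u \<in> S. u \<otimes> (a \<otimes> t \<ominus> b \<otimes> s) = \<zero>"
      then obtain u where "u \<in> S" "u \<otimes> (a \<otimes> t \<ominus> b \<otimes> s) = \<zero>" by blast
      moreover from \<open>u \<in> S\<close> have "u \<in> carrier R" "u \<noteq> \<zero>" using S_carr zero_notin by auto
      ultimately show "a \<otimes> t \<ominus> b \<otimes> s = \<zero>"
        using integral[of u "a \<otimes> t \<ominus> b \<otimes> s"] c by blast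
    next
      assume "a \<otimes> t \<ominus> b \<otimes> s = \<zero>"
      then show "\<exists>u \<in> S. u \<otimes> (a \<otimes> t \<ominus> b \<otimes> s) = \<zero>" using S_one by (intro bexI[of _ \<one>]) auto
    qed
    then show ?thesis using c by simp
  qed
  then show ?thesis unfolding loc_frac_def by auto
qed

private lemma cross_trans:
  assumes "a \<in> carrier R" "s \<in> S" "b \<in> carrier R" "t \<in> S" "c \<in> carrier R" "v \<in> S"
    and "a \<otimes> t = b \<otimes> s" "b \<otimes> v = c \<otimes> t"
  shows "a \<otimes> v = c \<otimes> s"
proof -
  have [simp]: "s \<in> carrier R" "t \<in> carrier R" "v \<in> carrier R" using assms S_carr by auto
  note [simp] = assms(1,3,5)
  have "t \<otimes> (a \<otimes> v) = (a \<otimes> t) \<otimes> v" by (simp add: m_ac)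
  also have "\<dots> = (b \<otimes> v) \<otimes> s" unfolding assms(7) by (simp add: m_ac)
  also have "\<dots> = t \<otimes> (c \<otimes> s)" unfolding assms(8) by (simp add: m_ac)
  finally show ?thesis
    using assms(4) zero_notin m_lcancel[of t "a \<otimes> v" "c \<otimes> s"] by auto
qed

lemma loc_frac_eq_iff:
  assumes "a \<in> carrier R" "s \<in> S" "b \<in> carrier R" "t \<in> S"
  shows "loc_frac R S a s = loc_frac R S b t \<longleftrightarrow> a \<otimes> t = b \<otimes> s"
proof
  assume "loc_frac R S a s = loc_frac R S b t"
  moreover have "(b, t) \<in> loc_frac R S b t" using assms by (simp add: mem_loc_frac_iff)
  ultimately have "(b, t) \<in> loc_frac R S a s" by simp
  then show "a \<otimes> t = b \<otimes> s" using assms by (simp add: mem_loc_frac_iff)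
next
  assume eq: "a \<otimes> t = b \<otimes> s"
  have "(c, v) \<in> loc_frac R S a s \<longleftrightarrow> (c, v) \<in> loc_frac R S b t" for c v
    unfolding mem_loc_frac_iff[OF assms(1,2)] mem_loc_frac_iff[OF assms(3,4)]
    using cross_trans[OF assms(1,2,3,4) _ _ eq] cross_trans[OF assms(3,4,1,2) _ _ eq[symmetric]]
    by blast
  then show "loc_frac R S a s = loc_frac R S b t" by auto
qed

private lemma UN_pairs_const:
  assumes "(a, s) \<in> X" "(b, t) \<in> Y"
    and "\<And>a s b t. (a, s) \<in> X \<Longrightarrow> (b, t) \<in> Y \<Longrightarrow> F a s b t = C"
  shows "(\<Union>(a, s) \<in> X. \<Union>(b, t) \<in> Y. F a s b t) = C"
proof (rule equalityI)
  show "(\<Union>(a, s) \<in> X. \<Union>(b, t) \<in> Y. F a s b t) \<subseteq> C"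
    by (auto simp: assms(3))
  have "C \<subseteq> (\<Union>(b, t) \<in> Y. F a s b t)"
    using UN_upper[OF assms(2), of "\<lambda>(b, t). F a s b t"] assms(3)[OF assms(1,2)] by simp
  then show "C \<subseteq> (\<Union>(a, s) \<in> X. \<Union>(b, t) \<in> Y. F a s b t)"
    using UN_upper[OF assms(1), of "\<lambda>(a, s). \<Union>(b, t) \<in> Y. F a s b t"] by simp
qed

lemma loc_mult_frac:
  assumes "a \<in> carrier R" "s \<in> S" "b \<in> carrier R" "t \<in> S"
  shows "loc_frac R S a s \<otimes>\<^bsub>localization R S\<^esub> loc_frac R S b t = loc_frac R S (a \<otimes> b) (s \<otimes> t)"
proof -
  have rep: "loc_frac R S (a' \<otimes> b') (s' \<otimes> t') = loc_frac R S (a \<otimes> b) (s \<otimes> t)"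
    if "(a', s') \<in> loc_frac R S a s" "(b', t') \<in> loc_frac R S b t" for a' s' b' t'
  proof -
    have h: "a' \<in> carrier R" "s' \<in> S" "a \<otimes> s' = a' \<otimes> s"
      "b' \<in> carrier R" "t' \<in> S" "b \<otimes> t' = b' \<otimes> t"
      using that unfolding mem_loc_frac_iff[OF assms(1,2)] mem_loc_frac_iff[OF assms(3,4)] by blast+
    note [simp] = assms(1,3) h(1,4) S_carr[OF assms(2)] S_carr[OF assms(4)]
      S_carr[OF h(2)] S_carr[OF h(5)]
    have "(a' \<otimes> b') \<otimes> (s \<otimes> t) = (a' \<otimes> s) \<otimes> (b' \<otimes> t)" by (simp add: m_ac)
    also have "\<dots> = (a \<otimes> s') \<otimes> (b \<otimes> t')" by (simp only: h(3,6))
    also have "\<dots> = (a \<otimes> b) \<otimes> (s' \<otimes> t')" by (simp add: m_ac)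
    finally have "(a' \<otimes> b') \<otimes> (s \<otimes> t) = (a \<otimes> b) \<otimes> (s' \<otimes> t')" .
    then show ?thesis
      by (subst loc_frac_eq_iff) (simp_all add: S_mult assms(2,4) h(2,5))
  qed
  have mem: "(a, s) \<in> loc_frac R S a s" "(b, t) \<in> loc_frac R S b t"
    using assms by (auto simp: mem_loc_frac_iff)
  show ?thesis
    unfolding localization_def monoid.simps ring.simps by (rule UN_pairs_const[OF mem rep])
qed

lemma loc_add_frac:
  assumes "a \<in> carrier R" "s \<in> S" "b \<in> carrier R" "t \<in> S"
  shows "loc_frac R S a s \<oplus>\<^bsub>localization R S\<^esub> loc_frac R S b t
    = loc_frac R S (a \<otimes> t \<oplus> b \<otimes> s) (s \<otimes> t)"
proof -
  have rep: "loc_frac R S (a' \<otimes> t' \<oplus> b' \<otimes> s') (s' \<otimes> t') = loc_frac R S (a \<otimes> t \<oplus> b \<otimes> s) (s \<otimes> t)"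
    if "(a', s') \<in> loc_frac R S a s" "(b', t') \<in> loc_frac R S b t" for a' s' b' t'
  proof -
    have h: "a' \<in> carrier R" "s' \<in> S" "a \<otimes> s' = a' \<otimes> s"
      "b' \<in> carrier R" "t' \<in> S" "b \<otimes> t' = b' \<otimes> t"
      using that unfolding mem_loc_frac_iff[OF assms(1,2)] mem_loc_frac_iff[OF assms(3,4)] by blast+
    note cs [simp] = assms(1,3) h(1,4) S_carr[OF assms(2)] S_carr[OF assms(4)]
      S_carr[OF h(2)] S_carr[OF h(5)]
    have "(a' \<otimes> t' \<oplus> b' \<otimes> s') \<otimes> (s \<otimes> t) = (a' \<otimes> s) \<otimes> (t' \<otimes> t) \<oplus> (b' \<otimes> t) \<otimes> (s' \<otimes> s)"
      using cs by algebra
    also have "\<dots> = (a \<otimes> s') \<otimes> (t' \<otimes> t) \<oplus> (b \<otimes> t') \<otimes> (s' \<otimes> s)" by (simp only: h(3,6))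
    also have "\<dots> = (a \<otimes> t \<oplus> b \<otimes> s) \<otimes> (s' \<otimes> t')" using cs by algebra
    finally have "(a' \<otimes> t' \<oplus> b' \<otimes> s') \<otimes> (s \<otimes> t) = (a \<otimes> t \<oplus> b \<otimes> s) \<otimes> (s' \<otimes> t')" .
    then show ?thesis
      by (subst loc_frac_eq_iff) (simp_all add: S_mult assms(2,4) h(2,5))
  qed
  have mem: "(a, s) \<in> loc_frac R S a s" "(b, t) \<in> loc_frac R S b t"
    using assms by (auto simp: mem_loc_frac_iff)
  show ?thesis
    unfolding localization_def monoid.simps ring.simps by (rule UN_pairs_const[OF mem rep])
qed

lemma localization_domain: "domain (localization R S)"
proof -
  let ?L = "localization R S" and ?f = "loc_frac R S"
  have carr: "carrier ?L = {?f a s | a s. a \<in> carrier R \<and> s \<in> S}"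
    and one: "\<one>\<^bsub>?L\<^esub> = ?f \<one> \<one>" and zero: "\<zero>\<^bsub>?L\<^esub> = ?f \<zero> \<one>"
    by (simp_all add: localization_def)
  have closed: "?f a s \<in> carrier ?L" if "a \<in> carrier R" "s \<in> S" for a s
    using that by (auto simp: carr)
  have fracE: "\<exists>a s. x = ?f a s \<and> a \<in> carrier R \<and> s \<in> S \<and> s \<in> carrier R" if "x \<in> carrier ?L" for x
    using that S_carr by (auto simp: carr)
  note eval = closed loc_mult_frac loc_add_frac loc_frac_eq_iff S_one S_mult
  have cring: "cring ?L"
  proof (rule cringI)
    show "abelian_group ?L"
    proof (rule abelian_groupI)
      fix x y z assume xyz: "x \<in> carrier ?L" "y \<in> carrier ?L" "z \<in> carrier ?L"
      from fracE[OF xyz(1)] obtain a s where [simp]: "x = ?f a s" "s \<in> S"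
        and as [simp]: "a \<in> carrier R" "s \<in> carrier R" by blast
      from fracE[OF xyz(2)] obtain b t where [simp]: "y = ?f b t" "t \<in> S"
        and bt [simp]: "b \<in> carrier R" "t \<in> carrier R" by blast
      from fracE[OF xyz(3)] obtain c v where [simp]: "z = ?f c v" "v \<in> S"
        and cv [simp]: "c \<in> carrier R" "v \<in> carrier R" by blast
      show "x \<oplus>\<^bsub>?L\<^esub> y \<in> carrier ?L" by (simp add: eval)
      show "x \<oplus>\<^bsub>?L\<^esub> y \<oplus>\<^bsub>?L\<^esub> z = x \<oplus>\<^bsub>?L\<^esub> (y \<oplus>\<^bsub>?L\<^esub> z)"
        by (simp add: eval) (use as bt cv in algebra)
      show "x \<oplus>\<^bsub>?L\<^esub> y = y \<oplus>\<^bsub>?L\<^esub> x" by (simp add: eval) (use as bt cv in algebra)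
      show "\<zero>\<^bsub>?L\<^esub> \<oplus>\<^bsub>?L\<^esub> x = x" by (simp add: zero eval)
      have "?f (\<ominus> a) s \<oplus>\<^bsub>?L\<^esub> x = \<zero>\<^bsub>?L\<^esub>" by (simp add: zero eval) (use as in algebra)
      then show "\<exists>y \<in> carrier ?L. y \<oplus>\<^bsub>?L\<^esub> x = \<zero>\<^bsub>?L\<^esub>"
        by (rule bexI) (simp add: closed)
    qed (simp add: zero eval)
    show "comm_monoid ?L"
    proof (rule comm_monoidI)
      fix x y z assume xyz: "x \<in> carrier ?L" "y \<in> carrier ?L" "z \<in> carrier ?L"
      from fracE[OF xyz(1)] obtain a s where [simp]: "x = ?f a s" "s \<in> S"
        and as [simp]: "a \<in> carrier R" "s \<in> carrier R" by blast
      from fracE[OF xyz(2)] obtain b t where [simp]: "y = ?f b t" "t \<in> S"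
        and bt [simp]: "b \<in> carrier R" "t \<in> carrier R" by blast
      from fracE[OF xyz(3)] obtain c v where [simp]: "z = ?f c v" "v \<in> S"
        and cv [simp]: "c \<in> carrier R" "v \<in> carrier R" by blast
      show "x \<otimes>\<^bsub>?L\<^esub> y \<in> carrier ?L" by (simp add: eval)
      show "x \<otimes>\<^bsub>?L\<^esub> y \<otimes>\<^bsub>?L\<^esub> z = x \<otimes>\<^bsub>?L\<^esub> (y \<otimes>\<^bsub>?L\<^esub> z)" by (simp add: eval) (use as bt cv in algebra)
      show "\<one>\<^bsub>?L\<^esub> \<otimes>\<^bsub>?L\<^esub> x = x" by (simp add: one eval)
      show "x \<otimes>\<^bsub>?L\<^esub> y = y \<otimes>\<^bsub>?L\<^esub> x" by (simp add: eval) (use as bt cv in algebra)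
    qed (simp add: one eval)
    fix x y z assume xyz: "x \<in> carrier ?L" "y \<in> carrier ?L" "z \<in> carrier ?L"
    from fracE[OF xyz(1)] obtain a s where [simp]: "x = ?f a s" "s \<in> S"
      and as [simp]: "a \<in> carrier R" "s \<in> carrier R" by blast
    from fracE[OF xyz(2)] obtain b t where [simp]: "y = ?f b t" "t \<in> S"
      and bt [simp]: "b \<in> carrier R" "t \<in> carrier R" by blast
    from fracE[OF xyz(3)] obtain c v where [simp]: "z = ?f c v" "v \<in> S"
      and cv [simp]: "c \<in> carrier R" "v \<in> carrier R" by blast
    show "(x \<oplus>\<^bsub>?L\<^esub> y) \<otimes>\<^bsub>?L\<^esub> z = x \<otimes>\<^bsub>?L\<^esub> z \<oplus>\<^bsub>?L\<^esub> y \<otimes>\<^bsub>?L\<^esub> z"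
      by (simp add: eval) (use as bt cv in algebra)
  qed
  show ?thesis
  proof (rule domain.intro[OF cring], rule domain_axioms.intro)
    show "\<one>\<^bsub>?L\<^esub> \<noteq> \<zero>\<^bsub>?L\<^esub>" by (simp add: one zero eval)
    fix x y assume *: "x \<otimes>\<^bsub>?L\<^esub> y = \<zero>\<^bsub>?L\<^esub>" "x \<in> carrier ?L" "y \<in> carrier ?L"
    from fracE[OF *(2)] obtain a s where [simp]: "x = ?f a s" "s \<in> S"
      and as [simp]: "a \<in> carrier R" "s \<in> carrier R" by blast
    from fracE[OF *(3)] obtain b t where [simp]: "y = ?f b t" "t \<in> S"
      and bt [simp]: "b \<in> carrier R" "t \<in> carrier R" by blast
    show "x = \<zero>\<^bsub>?L\<^esub> \<or> y = \<zero>\<^bsub>?L\<^esub>" using *(1) by (simp add: zero eval integral_iff)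
  qed
qed

end

end

theory Submission
  imports Defs
begin

text \<open>
  Write \<open>a/s\<close> for the fractions of the localization \<open>D\<^sub>S\<close>. Divisibility in \<open>D\<^sub>S\<close> is divisibility in
  \<open>D\<close> up to a factor from \<open>S\<close> (\<open>fraction_divides_iff\<close>), so \<open>D\<^sub>S\<close> and \<open>D\<close> have the same divisibility
  relation on those \<open>a\<close> for which the factor can be dropped: \<open>a\<close> divides \<open>u b\<close> with \<open>u \<in> S\<close> only if
  it divides \<open>b\<close>. Such an \<open>a\<close> is called contracted below, because the condition says that
  \<open>a D\<^sub>S \<inter> D = a D\<close>. A nonzero contracted \<open>a\<close> is prime in \<open>D\<close> exactly if \<open>a/1\<close> is prime in \<open>D\<^sub>S\<close>
  (\<open>fraction_prime_iff\<close>).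

  There are enough contracted elements. The ideal condition in the definition of a splitting set
  says that every element of \<open>D\<close> is a contracted one times an element of \<open>S\<close>
  (\<open>contracted_factorization\<close>), so every element of \<open>D\<^sub>S\<close> is a contracted one up to a unit; and a
  prime of \<open>D\<close> is contracted as soon as it lies outside \<open>S\<close> (\<open>prime_contracted\<close>). Hence the primes
  of \<open>D\<^sub>S\<close> are, up to units, the primes of \<open>D\<close> outside \<open>S\<close>, and such a prime divides \<open>x/s\<close> exactly
  if it divides \<open>x\<close>. What localizing forgets are the primes in \<open>S\<close>. They do not divide any nonzero
  contracted element (\<open>prime_in_S_not_divides_contracted\<close>), so those dividing \<open>x = a s\<close> divide \<open>s\<close>;
  and as \<open>s\<close> is a unit times a finite product of primes, there is at least one of them if \<open>s\<close> is
  not a unit, and there are always finitely many up to associates.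
\<close>


section \<open>Sets that are finite up to associates\<close>

definition finite_upto_assoc :: "('a, 'b) ring_scheme \<Rightarrow> 'a set \<Rightarrow> bool"
  where "finite_upto_assoc R P \<longleftrightarrow>
    (\<exists>F. finite F \<and> F \<subseteq> carrier R \<and> (\<forall>p \<in> P. \<exists>q \<in> F. p \<sim>\<^bsub>R\<^esub> q))"

lemma TPDF_domain_iff:
  "TPDF_domain R \<longleftrightarrow> strong_furstenberg_domain R \<and>
    (\<forall>x \<in> carrier R. x \<noteq> \<zero>\<^bsub>R\<^esub> \<longrightarrow> finite_upto_assoc R (prime_divisors R x))"
  by (simp add: TPDF_domain_def finite_upto_assoc_def)

lemma finite_upto_assoc_subset:
  "finite_upto_assoc R Q \<Longrightarrow> P \<subseteq> Q \<Longrightarrow> finite_upto_assoc R P"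
  unfolding finite_upto_assoc_def by blast

lemma finite_upto_assoc_Un:
  assumes "finite_upto_assoc R P" "finite_upto_assoc R Q"
  shows "finite_upto_assoc R (P \<union> Q)"
proof -
  obtain F G where "finite F" "F \<subseteq> carrier R" "\<forall>p \<in> P. \<exists>q \<in> F. p \<sim>\<^bsub>R\<^esub> q"
    "finite G" "G \<subseteq> carrier R" "\<forall>p \<in> Q. \<exists>q \<in> G. p \<sim>\<^bsub>R\<^esub> q"
    using assms unfolding finite_upto_assoc_def by blast
  then show ?thesis
    unfolding finite_upto_assoc_def by (intro exI[of _ "F \<union> G"]) blast
qed

text \<open>
  Pulls finiteness back along a map that is injective on associate classes; below \<open>f\<close> is \<open>p \<mapsto> p/1\<close>
  on contracted primes.
\<close>

lemma finite_upto_assoc_inj: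
  assumes L: "monoid L" and Q: "finite_upto_assoc L (f ` P)" and P: "P \<subseteq> carrier R"
    and f: "f ` P \<subseteq> carrier L"
    and inj: "\<And>p q. p \<in> P \<Longrightarrow> q \<in> P \<Longrightarrow> f p \<sim>\<^bsub>L\<^esub> f q \<Longrightarrow> p \<sim>\<^bsub>R\<^esub> q"
  shows "finite_upto_assoc R P"
proof -
  obtain F where F: "finite F" "F \<subseteq> carrier L" "\<forall>X \<in> f ` P. \<exists>Y \<in> F. X \<sim>\<^bsub>L\<^esub> Y"
    using Q unfolding finite_upto_assoc_def by blast
  \<comment> \<open>An element of \<open>F\<close> need not lie in the image, so one preimage is picked for each class that
    meets the image.\<close>
  define g where "g Y = (SOME p. p \<in> P \<and> f p \<sim>\<^bsub>L\<^esub> Y)" for Y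
  define F' where "F' = {Y \<in> F. \<exists>p \<in> P. f p \<sim>\<^bsub>L\<^esub> Y}"
  have g: "g Y \<in> P \<and> f (g Y) \<sim>\<^bsub>L\<^esub> Y" if "Y \<in> F'" for Y
  proof -
    have "\<exists>p. p \<in> P \<and> f p \<sim>\<^bsub>L\<^esub> Y" using that by (auto simp: F'_def)
    then show ?thesis unfolding g_def by (rule someI_ex)
  qed
  have "\<exists>q \<in> g ` F'. p \<sim>\<^bsub>R\<^esub> q" if p: "p \<in> P" for p
  proof -
    obtain Y where Y: "Y \<in> F" "f p \<sim>\<^bsub>L\<^esub> Y" using F(3) p by blast
    then have Y': "Y \<in> F'" using p by (auto simp: F'_def)
    have "Y \<sim>\<^bsub>L\<^esub> f (g Y)" using monoid.associated_sym[OF L] g[OF Y'] by blast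
    moreover have "f p \<in> carrier L" "f (g Y) \<in> carrier L" using f p g[OF Y'] by auto
    ultimately have "f p \<sim>\<^bsub>L\<^esub> f (g Y)"
      using monoid.associated_trans[OF L Y(2)] by blast
    then have "p \<sim>\<^bsub>R\<^esub> g Y" using inj p g[OF Y'] by blast
    then show ?thesis using Y' by blast
  qed
  moreover have "finite (g ` F')" "g ` F' \<subseteq> carrier R"
    using F(1) g P by (auto simp: F'_def)
  ultimately show ?thesis unfolding finite_upto_assoc_def by blast
qed


section \<open>Primes in an integral domain\<close>

context domain
begin

text \<open>
  With \<open>c = a d\<close> the equation \<open>a = p c\<close> becomes \<open>a = a (p d)\<close>, and \<open>a\<close> can be cancelled.
\<close>

lemma cofactor_unit:
  assumes a: "a = p \<otimes> c" "a divides c" "a \<noteq> \<zero>" and [simp]: "p \<in> carrier R" "c \<in> carrier R"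
  shows "p \<in> Units R"
proof -
  obtain d where d: "c = a \<otimes> d" and [simp]: "d \<in> carrier R" using a(2) by blast
  have [simp]: "a \<in> carrier R" unfolding a(1) by simp
  have "a \<otimes> (p \<otimes> d) = p \<otimes> (a \<otimes> d)" by (rule m_lcomm) simp_all
  also have "\<dots> = a \<otimes> \<one>" using a(1) d by simp
  finally have "p \<otimes> d = \<one>" using a(3) m_lcancel[of a "p \<otimes> d" \<one>] by simp
  then have "p divides \<one>" by (metis dividesI \<open>d \<in> carrier R\<close>)
  then show ?thesis using divides_one by simp
qed

lemma mem_PIdl_iff:
  assumes "a \<in> carrier R"
  shows "x \<in> PIdl a \<longleftrightarrow> a divides x"
  using assms m_comm unfolding cgenideal_def factor_def by fastforce

lemma ring_prime_divides_mult:
  assumes "ring_prime p" "p divides a \<otimes> b" "a \<in> carrier R" "b \<in> carrier R"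
  shows "p divides a \<or> p divides b"
  using assms unfolding ring_prime_def prime_def by blast

lemma ring_prime_not_unit: "ring_prime p \<Longrightarrow> p \<notin> Units R"
  unfolding ring_prime_def prime_def by blast

lemma ring_prime_not_divides_unit:
  assumes "ring_prime p" "p \<in> carrier R" "u \<in> Units R"
  shows "\<not> p divides u"
  using assms divides_unit ring_prime_not_unit by blast

lemma ring_prime_assoc:
  assumes "p \<sim> q" "ring_prime p" "p \<in> carrier R" "q \<in> carrier R"
  shows "ring_prime q"
proof -
  have pq: "p divides q" and qp: "q divides p" using assms(1) by (auto simp: associated_def)
  have "q \<noteq> \<zero>" using qp assms(2) zero_divides by (auto simp: ring_prime_def)
  moreover have "q \<notin> Units R" using assms pq ring_prime_not_divides_unit by blast
  moreover have "q divides a \<or> q divides b"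
    if "a \<in> carrier R" "b \<in> carrier R" "q divides a \<otimes> b" for a b
    using that ring_prime_divides_mult[OF assms(2)] divides_trans[OF pq that(3) assms(3)]
      divides_trans[OF qp _ assms(4)] by blast
  ultimately show ?thesis by (simp add: ring_prime_def primeI)
qed

lemma ring_prime_divides_prime:
  assumes "ring_prime p" "ring_prime q" "p \<in> carrier R" "q \<in> carrier R" "p divides q"
  shows "p \<sim> q"
proof -
  obtain c where c: "q = p \<otimes> c" "c \<in> carrier R" using assms(5) by auto
  have "q divides p \<or> q divides c"
    using ring_prime_divides_mult[OF assms(2), of p c] c assms by simp
  moreover have "\<not> q divides c"
  proof
    assume "q divides c"
    moreover have "q \<noteq> \<zero>" using assms(2) by (simp add: ring_prime_def)
    ultimately have "p \<in> Units R" using cofactor_unit c assms(3) by blast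
    then show False using assms(1) ring_prime_not_unit by blast
  qed
  ultimately show ?thesis using assms(5) by (simp add: associated_def)
qed

lemma ring_prime_divides_prod_list:
  assumes "ring_prime p" "p \<in> carrier R" "set ps \<subseteq> carrier R" "p divides foldr (\<otimes>) ps \<one>"
  shows "\<exists>q \<in> set ps. p divides q"
  using assms(3,4)
proof (induction ps)
  case Nil
  then show ?case using ring_prime_not_divides_unit[OF assms(1,2) Units_one_closed] by simp
next
  case (Cons q ps)
  have "foldr (\<otimes>) ps \<one> \<in> carrier R"
    using Cons.prems(1) by simp
  then have "p divides q \<or> p divides foldr (\<otimes>) ps \<one>"
    using Cons.prems ring_prime_divides_mult[OF assms(1)] by simp
  then show ?case using Cons.IH Cons.prems(1) by fastforce
qed

end


section \<open>Contracted elements\<close>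

locale domain_saturated = domain R for R (structure) +
  fixes S
  assumes saturated: "saturated_mult_subset R S"
begin

abbreviation "L \<equiv> localization R S"
abbreviation "fraction \<equiv> loc_frac R S"

text \<open>In terms of ideals: \<open>a D\<^sub>S \<inter> D = a D\<close>.\<close>

definition contracted :: "'a \<Rightarrow> bool"
  where "contracted a \<longleftrightarrow> a \<in> carrier R \<and>
    (\<forall>u \<in> S. \<forall>b \<in> carrier R. a divides u \<otimes> b \<longrightarrow> a divides b)"

lemma submonoid_S: "submonoid S R" and zero_notin_S: "\<zero> \<notin> S"
  using saturated by (auto simp: saturated_mult_subset_def)

lemma S_carrier [simp]: "s \<in> S \<Longrightarrow> s \<in> carrier R"
  using submonoid_S by (simp add: submonoid.mem_carrier)

lemma S_mult [simp]: "s \<in> S \<Longrightarrow> t \<in> S \<Longrightarrow> s \<otimes> t \<in> S"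
  using submonoid_S by (rule submonoid.m_closed)

lemma S_one [simp]: "\<one> \<in> S"
  using submonoid_S by (rule submonoid.one_closed)

lemma S_factor: "a \<otimes> b \<in> S \<Longrightarrow> a \<in> carrier R \<Longrightarrow> b \<in> carrier R \<Longrightarrow> a \<in> S"
  using saturated unfolding saturated_mult_subset_def by blast

lemma S_divisor: "a divides s \<Longrightarrow> s \<in> S \<Longrightarrow> a \<in> carrier R \<Longrightarrow> a \<in> S"
  by (metis S_factor dividesD)

lemma Units_subset_S: "u \<in> Units R \<Longrightarrow> u \<in> S"
  using S_divisor[of u \<one>] unit_divides Units_closed by simp

lemma contracted_carrier [simp]: "contracted a \<Longrightarrow> a \<in> carrier R"
  by (simp add: contracted_def)

lemma contractedD:
  "contracted a \<Longrightarrow> a divides u \<otimes> b \<Longrightarrow> u \<in> S \<Longrightarrow> b \<in> carrier R \<Longrightarrow> a divides b"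
  unfolding contracted_def by blast

text \<open>
  If \<open>a\<close> divides \<open>u b\<close>, then \<open>u b\<close> lies in \<open>a D \<inter> u D\<close>; if this is \<open>a u D\<close>, then \<open>u\<close> can be
  cancelled.
\<close>

lemma contracted_if_PIdl_Int:
  assumes a: "a \<in> carrier R" and int: "\<forall>t \<in> S. PIdl a \<inter> PIdl t = PIdl (a \<otimes> t)"
  shows "contracted a"
  unfolding contracted_def
proof (intro conjI ballI impI a)
  fix u b assume u: "u \<in> S" and b: "b \<in> carrier R" and dvd: "a divides u \<otimes> b"
  have "u \<otimes> b \<in> PIdl a \<inter> PIdl u" using dvd u b a dividesI' by (auto simp: mem_PIdl_iff)
  then have "u \<otimes> b \<in> PIdl (a \<otimes> u)" using int u by blast
  then have "u \<otimes> a divides u \<otimes> b" using u a by (simp add: mem_PIdl_iff m_comm)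
  then show "a divides b" using mult_divides[of a b u] u a b zero_notin_S by auto
qed

text \<open>
  If \<open>p\<close> divides \<open>u b\<close> with \<open>u \<in> S\<close>, it cannot divide \<open>u\<close>: as \<open>S\<close> is saturated, it would then lie
  in \<open>S\<close>.
\<close>

lemma prime_contracted:
  assumes "ring_prime p" "p \<in> carrier R" "p \<notin> S"
  shows "contracted p"
  unfolding contracted_def using assms ring_prime_divides_mult[OF assms(1)] S_divisor S_carrier
  by blast

text \<open>
  The factor \<open>a \<in> S\<close> can be dropped from \<open>a \<cdot> 1\<close>, so \<open>a\<close> divides \<open>1\<close>.
\<close>

lemma contracted_in_S_unit:
  assumes "contracted a" "a \<in> S"
  shows "a \<in> Units R"
proof -
  have "a divides a \<otimes> \<one>" using assms(2) by simp
  then have "a divides \<one>" using contractedD assms by blast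
  then show ?thesis using assms divides_one by simp
qed

text \<open>If \<open>a = p c\<close>, then already \<open>c\<close> is divisible by the contracted \<open>a\<close>, and so \<open>p\<close> is a unit.\<close>

lemma prime_in_S_not_divides_contracted:
  assumes p: "ring_prime p" "p \<in> S" and a: "contracted a" "a \<noteq> \<zero>"
  shows "\<not> p divides a"
proof
  assume "p divides a"
  then obtain c where c: "a = p \<otimes> c" "c \<in> carrier R" by auto
  have "a divides p \<otimes> c" using a c by simp
  then have "a divides c" using contractedD[OF a(1)] p c by blast
  then have "p \<in> Units R" using cofactor_unit c a(2) p(2) by simp
  then show False using p(1) ring_prime_not_unit by blast
qed


section \<open>Divisibility and primes in the localization\<close>

lemmas loc_facts = domain_axioms submonoid_S zero_notin_S

sublocale L: domain L
  by (rule localization_domain[OF loc_facts])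

lemma fraction_carrier [simp]: "a \<in> carrier R \<Longrightarrow> s \<in> S \<Longrightarrow> fraction a s \<in> carrier L"
  by (auto simp: localization_def)

lemma L_cases:
  assumes "X \<in> carrier L"
  obtains a s where "X = fraction a s" "a \<in> carrier R" "s \<in> S"
  using assms by (auto simp: localization_def)

lemmas fraction_eq_iff = loc_frac_eq_iff[OF loc_facts]
lemmas fraction_mult = loc_mult_frac[OF loc_facts]

lemma L_one: "\<one>\<^bsub>L\<^esub> = fraction \<one> \<one>" and L_zero: "\<zero>\<^bsub>L\<^esub> = fraction \<zero> \<one>"
  by (simp_all add: localization_def)

lemma fraction_eq_zero_iff: "a \<in> carrier R \<Longrightarrow> s \<in> S \<Longrightarrow> fraction a s = \<zero>\<^bsub>L\<^esub> \<longleftrightarrow> a = \<zero>"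
  by (simp add: L_zero fraction_eq_iff)

lemma fraction_divides_iff:
  assumes a: "a \<in> carrier R" "s \<in> S" and b: "b \<in> carrier R" "t \<in> S"
  shows "fraction a s divides\<^bsub>L\<^esub> fraction b t \<longleftrightarrow> (\<exists>u \<in> S. a divides u \<otimes> b)"
proof
  assume "fraction a s divides\<^bsub>L\<^esub> fraction b t"
  then obtain C where C: "fraction b t = fraction a s \<otimes>\<^bsub>L\<^esub> C" "C \<in> carrier L" by auto
  obtain c v where c: "C = fraction c v" "c \<in> carrier R" "v \<in> S" using C(2) by (rule L_cases)
  have "fraction b t = fraction (a \<otimes> c) (s \<otimes> v)" using C c a by (simp add: fraction_mult)
  then have "b \<otimes> (s \<otimes> v) = a \<otimes> c \<otimes> t" using a b c by (simp add: fraction_eq_iff)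
  then have "(s \<otimes> v) \<otimes> b = a \<otimes> (c \<otimes> t)" using a b c by (simp add: m_ac)
  then have "a divides (s \<otimes> v) \<otimes> b" using b c by auto
  then show "\<exists>u \<in> S. a divides u \<otimes> b" using a c by auto
next
  assume "\<exists>u \<in> S. a divides u \<otimes> b"
  then obtain u c where u: "u \<in> S" "u \<otimes> b = a \<otimes> c" "c \<in> carrier R" by auto
  have "b \<otimes> (s \<otimes> (u \<otimes> t)) = (u \<otimes> b) \<otimes> (s \<otimes> t)" using a b u(1) by (simp add: m_ac)
  also have "\<dots> = (a \<otimes> (c \<otimes> s)) \<otimes> t" unfolding u(2) using a b u(1,3) by (simp add: m_ac)
  finally have "fraction b t = fraction a s \<otimes>\<^bsub>L\<^esub> fraction (c \<otimes> s) (u \<otimes> t)"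
    using a b u by (simp add: fraction_mult fraction_eq_iff)
  then show "fraction a s divides\<^bsub>L\<^esub> fraction b t" using a b u by auto
qed

lemma fraction_unit_iff:
  assumes a: "a \<in> carrier R" "s \<in> S"
  shows "fraction a s \<in> Units L \<longleftrightarrow> a \<in> S"
proof -
  have "fraction a s \<in> Units L \<longleftrightarrow> fraction a s divides\<^bsub>L\<^esub> fraction \<one> \<one>"
    using L.divides_one[of "fraction a s"] a by (simp add: L_one)
  also have "\<dots> \<longleftrightarrow> (\<exists>u \<in> S. a divides u)" using a by (simp add: fraction_divides_iff)
  also have "\<dots> \<longleftrightarrow> a \<in> S" using a S_divisor by (metis divides_refl)
  finally show ?thesis .
qed

lemma fraction_divides_if_divides:
  assumes "a divides b" "a \<in> carrier R" "s \<in> S" "b \<in> carrier R" "t \<in> S"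
  shows "fraction a s divides\<^bsub>L\<^esub> fraction b t"
  using assms by (subst fraction_divides_iff) (auto intro!: bexI[of _ \<one>])

lemma fraction_divides_contracted_iff:
  assumes "contracted a" "s \<in> S" "b \<in> carrier R" "t \<in> S"
  shows "fraction a s divides\<^bsub>L\<^esub> fraction b t \<longleftrightarrow> a divides b"
  using assms fraction_divides_if_divides fraction_divides_iff contractedD
  by (meson contracted_carrier)

text \<open>
  All divisibilities by \<open>a\<close> in the definition of a prime mean the same in \<open>D\<close> and in \<open>D\<^sub>S\<close>. Units
  match as well, because the only contracted elements that become invertible, namely those in \<open>S\<close>,
  already are.
\<close>

lemma fraction_prime_iff:
  assumes a: "contracted a" and s: "s \<in> S"
  shows "ring_prime\<^bsub>L\<^esub> (fraction a s) \<longleftrightarrow> ring_prime a"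
proof -
  have unit: "fraction a s \<in> Units L \<longleftrightarrow> a \<in> Units R"
    using fraction_unit_iff contracted_in_S_unit Units_subset_S a s by auto
  have "(\<forall>X \<in> carrier L. \<forall>Y \<in> carrier L.
      fraction a s divides\<^bsub>L\<^esub> X \<otimes>\<^bsub>L\<^esub> Y \<longrightarrow> fraction a s divides\<^bsub>L\<^esub> X \<or> fraction a s divides\<^bsub>L\<^esub> Y) \<longleftrightarrow>
    (\<forall>x \<in> carrier R. \<forall>y \<in> carrier R. a divides x \<otimes> y \<longrightarrow> a divides x \<or> a divides y)"
    (is "?PL \<longleftrightarrow> ?P")
  proof
    assume PL: ?PL
    show ?P
    proof (intro ballI impI)
      fix x y assume xy: "x \<in> carrier R" "y \<in> carrier R" and dvd: "a divides x \<otimes> y"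
      have "fraction a s divides\<^bsub>L\<^esub> fraction x \<one> \<otimes>\<^bsub>L\<^esub> fraction y \<one>"
        using xy dvd a s by (simp add: fraction_mult fraction_divides_contracted_iff)
      then have "fraction a s divides\<^bsub>L\<^esub> fraction x \<one> \<or> fraction a s divides\<^bsub>L\<^esub> fraction y \<one>"
        using PL xy fraction_carrier[OF _ S_one] by blast
      then show "a divides x \<or> a divides y"
        using xy a s by (simp add: fraction_divides_contracted_iff)
    qed
  next
    assume P: ?P
    show ?PL
    proof (intro ballI impI)
      fix X Y assume "X \<in> carrier L" "Y \<in> carrier L"
        and dvd: "fraction a s divides\<^bsub>L\<^esub> X \<otimes>\<^bsub>L\<^esub> Y"
      then obtain x t y v where xy: "X = fraction x t" "x \<in> carrier R" "t \<in> S"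
        "Y = fraction y v" "y \<in> carrier R" "v \<in> S" by (metis L_cases)
      have "a divides x \<otimes> y"
        using dvd xy a s by (simp add: fraction_mult fraction_divides_contracted_iff)
      then have "a divides x \<or> a divides y" using P xy by blast
      then show "fraction a s divides\<^bsub>L\<^esub> X \<or> fraction a s divides\<^bsub>L\<^esub> Y"
        using xy a s by (simp add: fraction_divides_contracted_iff)
    qed
  qed
  moreover have "fraction a s = \<zero>\<^bsub>L\<^esub> \<longleftrightarrow> a = \<zero>" using fraction_eq_zero_iff a s by simp
  ultimately show ?thesis by (simp only: ring_prime_def prime_def unit)
qed

end


section \<open>Splitting sets generated by primes\<close>

locale prime_splitting_domain = domain R for R (structure) +
  fixes S
  assumes splitting: "splitting_mult_subset R S"
    and generated: "generated_by_primes R S"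
begin

sublocale domain_saturated R S
  using splitting by unfold_locales (simp add: splitting_mult_subset_def)

lemma contracted_factorization:
  assumes "x \<in> carrier R"
  obtains a s where "x = a \<otimes> s" "contracted a" "s \<in> S"
  using assms splitting contracted_if_PIdl_Int unfolding splitting_mult_subset_def by blast

lemma fraction_assoc_contracted:
  assumes "X \<in> carrier L"
  obtains a where "contracted a" "fraction a \<one> \<sim>\<^bsub>L\<^esub> X"
proof -
  obtain x t where X: "X = fraction x t" "x \<in> carrier R" "t \<in> S" using assms by (rule L_cases)
  obtain a s where a: "x = a \<otimes> s" "contracted a" "s \<in> S"
    using X(2) by (rule contracted_factorization)
  have "fraction a \<one> divides\<^bsub>L\<^esub> X"
    using fraction_divides_if_divides[OF dividesI[OF _ a(1)]] X a by simp
  moreover have "X divides\<^bsub>L\<^esub> fraction a \<one>"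
    using fraction_divides_iff[of x t a \<one>] X a by (auto simp: m_comm intro!: bexI[of _ s])
  ultimately show ?thesis using that a(2) by (simp add: associated_def)
qed

text \<open>
  Together with the next lemma: the prime divisors of \<open>x/s\<close> are, up to associates, the fractions
  \<open>p/1\<close> for the contracted prime divisors \<open>p\<close> of \<open>x\<close>.
\<close>

lemma localized_prime_from_contracted_prime:
  assumes X: "X \<in> prime_divisors L (fraction x s)" and x: "x \<in> carrier R" "s \<in> S"
  obtains p where "contracted p" "p \<in> prime_divisors R x" "fraction p \<one> \<sim>\<^bsub>L\<^esub> X"
proof -
  have XL: "X \<in> carrier L" "ring_prime\<^bsub>L\<^esub> X" "X divides\<^bsub>L\<^esub> fraction x s"
    using X by (auto simp: prime_divisors_def)
  obtain p where p: "contracted p" "fraction p \<one> \<sim>\<^bsub>L\<^esub> X"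
    using XL(1) by (rule fraction_assoc_contracted)
  have "ring_prime\<^bsub>L\<^esub> (fraction p \<one>)"
    using L.ring_prime_assoc[OF L.associated_sym[OF p(2)]] XL p(1) by simp
  then have "ring_prime p" using fraction_prime_iff p(1) by simp
  moreover have "fraction p \<one> divides\<^bsub>L\<^esub> fraction x s"
    using L.divides_cong_l[OF p(2) XL(3)] p(1) by simp
  then have "p divides x" using fraction_divides_contracted_iff p(1) x by simp
  ultimately show ?thesis using that p by (simp add: prime_divisors_def)
qed

lemma contracted_prime_localizes:
  assumes "contracted p" "p \<in> prime_divisors R x" "x \<in> carrier R" "s \<in> S"
  shows "fraction p \<one> \<in> prime_divisors L (fraction x s)"
  using assms fraction_prime_iff fraction_divides_contracted_iff by (auto simp: prime_divisors_def)

lemma S_prime_factorization: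
  assumes "s \<in> S"
  obtains u ps where "u \<in> Units R" "set ps \<subseteq> S" "\<forall>p \<in> set ps. ring_prime p"
    "s = u \<otimes> foldr (\<otimes>) ps \<one>"
  using assms generated unfolding generated_by_primes_def by blast

lemma S_nonunit_has_prime_divisor:
  assumes s: "s \<in> S" "s \<notin> Units R"
  shows "prime_divisors R s \<noteq> {}"
proof -
  obtain u ps where u: "u \<in> Units R" "set ps \<subseteq> S" "\<forall>p \<in> set ps. ring_prime p"
    "s = u \<otimes> foldr (\<otimes>) ps \<one>"
    using s(1) by (rule S_prime_factorization)
  obtain p qs where ps: "ps = p # qs" using u s(2) by (cases ps) auto
  have c: "p \<in> carrier R" "u \<in> carrier R" "foldr (\<otimes>) qs \<one> \<in> carrier R"
    using u ps by (auto intro!: multlist_closed)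
  have "s = p \<otimes> (u \<otimes> foldr (\<otimes>) qs \<one>)" using u(4) ps c by (simp add: m_lcomm)
  then have "p divides s" using c by auto
  then show ?thesis using u(3) ps c by (auto simp: prime_divisors_def)
qed

text \<open>
  A prime that divides a unit times a product of primes divides one of these primes, and is then
  associated to it.
\<close>

lemma finite_upto_assoc_primes_S:
  assumes s: "s \<in> S"
  shows "finite_upto_assoc R (prime_divisors R s)"
proof -
  obtain u ps where u: "u \<in> Units R" "set ps \<subseteq> S" "\<forall>p \<in> set ps. ring_prime p"
    "s = u \<otimes> foldr (\<otimes>) ps \<one>"
    using s by (rule S_prime_factorization)
  have ps: "set ps \<subseteq> carrier R" using u(2) by auto
  have "\<exists>q \<in> set ps. p \<sim> q" if "p \<in> prime_divisors R s" for p
  proof -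
    have p: "p \<in> carrier R" "ring_prime p" "p divides s"
      using that by (auto simp: prime_divisors_def)
    have "p divides u \<or> p divides foldr (\<otimes>) ps \<one>"
      using ring_prime_divides_mult[OF p(2)] p(3) u(1,4) ps
      by (simp add: Units_closed)
    then have "p divides foldr (\<otimes>) ps \<one>" using ring_prime_not_divides_unit p u(1) by blast
    then obtain q where "q \<in> set ps" "p divides q"
      using ring_prime_divides_prod_list p ps by blast
    then show ?thesis using ring_prime_divides_prime p u(3) ps by blast
  qed
  then show ?thesis unfolding finite_upto_assoc_def using ps by blast
qed

text \<open>
  From \<open>D\<close> to \<open>D\<^sub>S\<close>, a prime divisor of \<open>x\<close> itself would not help, because it may lie in \<open>S\<close> and
  become a unit. A prime divisor of the contracted part of \<open>x\<close> stays prime.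
\<close>

lemma strong_furstenberg_iff: "strong_furstenberg_domain R \<longleftrightarrow> strong_furstenberg_domain L"
proof
  assume R: "strong_furstenberg_domain R"
  have "prime_divisors L X \<noteq> {}" if X: "X \<in> carrier L" "X \<noteq> \<zero>\<^bsub>L\<^esub>" "X \<notin> Units L" for X
  proof -
    obtain x t where x: "X = fraction x t" "x \<in> carrier R" "t \<in> S" using X(1) by (rule L_cases)
    obtain a s where a: "x = a \<otimes> s" "contracted a" "s \<in> S"
      using x(2) by (rule contracted_factorization)
    have "x \<noteq> \<zero>" using fraction_eq_zero_iff X x by blast
    then have a0: "a \<noteq> \<zero>" using a by auto
    have "x \<notin> S" using fraction_unit_iff X x by blast
    then have "a \<notin> Units R" using a Units_subset_S by auto
    then have "prime_divisors R a \<noteq> {}"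
      using R a0 contracted_carrier[OF a(2)] unfolding strong_furstenberg_domain_def by blast
    then obtain p where p: "p \<in> carrier R" "ring_prime p" "p divides a"
      unfolding prime_divisors_def by blast
    then have "contracted p"
      using prime_contracted prime_in_S_not_divides_contracted a(2) a0 by blast
    moreover have "p divides x" using p a divides_prod_r by simp
    ultimately have "fraction p \<one> \<in> prime_divisors L X"
      using contracted_prime_localizes p x by (simp add: prime_divisors_def)
    then show ?thesis by blast
  qed
  then show "strong_furstenberg_domain L"
    unfolding strong_furstenberg_domain_def using L.domain_axioms by blast
next
  assume L: "strong_furstenberg_domain L"
  have "prime_divisors R x \<noteq> {}" if x: "x \<in> carrier R" "x \<noteq> \<zero>" "x \<notin> Units R" for x
  proof (cases "x \<in> S")
    case True
    then show ?thesis using S_nonunit_has_prime_divisor x by blast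
  next
    case False
    then have "fraction x \<one> \<in> carrier L" "fraction x \<one> \<noteq> \<zero>\<^bsub>L\<^esub>" "fraction x \<one> \<notin> Units L"
      using x fraction_unit_iff fraction_eq_zero_iff by simp_all
    then obtain X where X: "X \<in> prime_divisors L (fraction x \<one>)"
      using L unfolding strong_furstenberg_domain_def by blast
    obtain p where "p \<in> prime_divisors R x"
      using X x(1) S_one by (rule localized_prime_from_contracted_prime)
    then show ?thesis by blast
  qed
  then show "strong_furstenberg_domain R"
    unfolding strong_furstenberg_domain_def using domain_axioms by blast
qed

lemma finite_upto_assoc_primes_localization:
  assumes fin: "finite_upto_assoc R (prime_divisors R x)" and x: "x \<in> carrier R" "s \<in> S"
  shows "finite_upto_assoc L (prime_divisors L (fraction x s))"
proof -
  obtain F where F: "finite F" "F \<subseteq> carrier R" "\<forall>p \<in> prime_divisors R x. \<exists>q \<in> F. p \<sim> q"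
    using fin unfolding finite_upto_assoc_def by blast
  have "\<exists>Y \<in> (\<lambda>q. fraction q \<one>) ` F. X \<sim>\<^bsub>L\<^esub> Y" if X: "X \<in> prime_divisors L (fraction x s)" for X
  proof -
    obtain p where p: "contracted p" "p \<in> prime_divisors R x" "fraction p \<one> \<sim>\<^bsub>L\<^esub> X"
      using X x by (rule localized_prime_from_contracted_prime)
    obtain q where q: "q \<in> F" "p \<sim> q" using F(3) p(2) by blast
    have "fraction p \<one> \<sim>\<^bsub>L\<^esub> fraction q \<one>"
      using q F(2) p(1) fraction_divides_if_divides unfolding associated_def by auto
    then have "X \<sim>\<^bsub>L\<^esub> fraction q \<one>"
      using L.associated_trans[OF L.associated_sym[OF p(3)]] X q F(2)
      by (auto simp: prime_divisors_def)
    then show ?thesis using q(1) by blast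
  qed
  then show ?thesis
    unfolding finite_upto_assoc_def using F(1,2)
    by (intro exI[of _ "(\<lambda>q. fraction q \<one>) ` F"]) auto
qed

text \<open>
  The prime divisors of \<open>x = a s\<close> outside \<open>S\<close> are counted in \<open>D\<^sub>S\<close>, where no two classes of
  associates merge because the primes are contracted. Those in \<open>S\<close> do not divide the contracted
  factor \<open>a\<close>, so they divide \<open>s\<close>, and up to associates only
  finitely many primes do.
\<close>

lemma finite_upto_assoc_primes_delocalization:
  assumes fin: "finite_upto_assoc L (prime_divisors L (fraction x \<one>))"
    and x: "x \<in> carrier R" "x \<noteq> \<zero>"
  shows "finite_upto_assoc R (prime_divisors R x)"
proof -
  obtain a s where a: "x = a \<otimes> s" "contracted a" "s \<in> S"
    using x(1) by (rule contracted_factorization)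
  have a0: "a \<noteq> \<zero>" using x a by auto
  define P where "P = {p \<in> prime_divisors R x. contracted p}"
  have P: "P \<subseteq> carrier R" "(\<lambda>p. fraction p \<one>) ` P \<subseteq> prime_divisors L (fraction x \<one>)"
    using contracted_prime_localizes x by (auto simp: P_def)
  have "finite_upto_assoc R P"
  proof (rule finite_upto_assoc_inj[OF L.monoid_axioms finite_upto_assoc_subset[OF fin P(2)] P(1)])
    show "(\<lambda>p. fraction p \<one>) ` P \<subseteq> carrier L" using P(1) by auto
    show "p \<sim> q" if "p \<in> P" "q \<in> P" "fraction p \<one> \<sim>\<^bsub>L\<^esub> fraction q \<one>" for p q
      using that fraction_divides_contracted_iff by (auto simp: P_def associated_def)
  qed
  moreover have "prime_divisors R x \<subseteq> P \<union> prime_divisors R s"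
  proof
    fix p assume px: "p \<in> prime_divisors R x"
    then have p: "p \<in> carrier R" "ring_prime p" "p divides a \<otimes> s"
      using a by (auto simp: prime_divisors_def)
    show "p \<in> P \<union> prime_divisors R s"
    proof (cases "p \<in> S")
      case True
      then have "p divides s"
        using ring_prime_divides_mult[OF p(2,3)] prime_in_S_not_divides_contracted p(2) a(2,3) a0
          contracted_carrier S_carrier by blast
      then show ?thesis using p by (simp add: prime_divisors_def)
    next
      case False
      then show ?thesis using prime_contracted p px by (simp add: P_def)
    qed
  qed
  ultimately show ?thesis
    using finite_upto_assoc_Un finite_upto_assoc_primes_S[OF a(3)] finite_upto_assoc_subset
    by blast
qed

lemma TPDF_iff: "TPDF_domain R \<longleftrightarrow> TPDF_domain L"
proof -
  have "(\<forall>x \<in> carrier R. x \<noteq> \<zero> \<longrightarrow> finite_upto_assoc R (prime_divisors R x)) \<longleftrightarrow>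
    (\<forall>X \<in> carrier L. X \<noteq> \<zero>\<^bsub>L\<^esub> \<longrightarrow> finite_upto_assoc L (prime_divisors L X))"
    (is "?R \<longleftrightarrow> ?L")
  proof
    assume ?R
    then show ?L
      using finite_upto_assoc_primes_localization fraction_eq_zero_iff by (metis L_cases)
  next
    assume ?L
    then show ?R
      using finite_upto_assoc_primes_delocalization fraction_eq_zero_iff by simp
  qed
  then show ?thesis by (simp add: TPDF_domain_iff strong_furstenberg_iff)
qed

end

theorem corollary4p12:
  fixes D :: "('a, 'b) ring_scheme" and S :: "'a set"
  assumes "domain D"
    and "splitting_mult_subset D S"
    and "generated_by_primes D S"
  shows "(strong_furstenberg_domain D \<longleftrightarrow> strong_furstenberg_domain (localization D S)) \<and>
         (TPDF_domain D \<longleftrightarrow> TPDF_domain (localization D S))"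
proof -
  interpret prime_splitting_domain D S
    using assms by (simp add: prime_splitting_domain_def prime_splitting_domain_axioms_def)
  show ?thesis using strong_furstenberg_iff TPDF_iff by blast
qed

end
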